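(* If $\mathcal{I}$ is an ideal on $\omega$ with $\mathrm{fin} \subseteq \mathcal{I}$ which is Baire measurable (as a subset of $2^\omega$) and uniformly weakly Ramsey, then there exists a Borel $\mathcal{I}$-MED family $\mathcal{E} \subseteq \omega^\omega$.
   Context: $\mathrm{fin}$ is the ideal of finite subsets of $\omega$; $\mathcal{I}^+$ denotes subsets of $\omega$ not in $\mathcal{I}$; for $A \subseteq \omega$, $\mathcal{I}|A = \{I \subseteq A : I \in \mathcal{I}\}$ and $(\mathcal{I}|A)^+$ is the family of subsets of $A$ not in $\mathcal{I}$. A coloring is $c : [\omega]^2 \to 2$; it is subadditive if $c(\{m,n\}) \le c(\{m,k\}) + c(\{n,k\})$ for all $m<n<k$. $H$ is 0-homogeneous for $c$ if $c(\{m,n\})=0$ for all distinct $m,n\in H$; $H$ is nowhere 0-homogeneous if every $B \in (\mathcal{I}|H)^+$ contains distinct $m,n$ with $c(\{m,n\})=1$. $\mathcal{I}$ is uniformly weakly Ramsey if there is a Borel $\Phi : [\omega]^\omega \times 2^{[\omega]^2} \to [\omega]^\omega$ such that for every $A \in \mathcal{I}^+$ and every subadditive coloring $c$, $\Phi(A,c) \in (\mathcal{I}|A)^+$ and $\Phi(A,c)$ is 0-homogeneous or nowhere 0-homogeneous for $c$. Functions $f,g \in \omega^\omega$ are $\mathcal{I}$-ED if $\{n : f(n)=g(n)\} \in \mathcal{I}$; $\mathcal{E} \subseteq \omega^\omega$ is an $\mathcal{I}$-MED family if any two distinct members are $\mathcal{I}$-ED and for every $h \in \omega^\omega$ some $f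 \in \mathcal{E}$ is not $\mathcal{I}$-ED from $h$. *)

theory Defs
  imports "HOL-Analysis.Analysis"
begin

definition nowhere_dense :: "'a::topological_space set \<Rightarrow> bool" where
  "nowhere_dense S \<longleftrightarrow> interior (closure S) = {}"

definition meager :: "'a::topological_space set \<Rightarrow> bool" where
  "meager S \<longleftrightarrow> (\<exists>F::nat \<Rightarrow> 'a set. (\<forall>n. nowhere_dense (F n)) \<and> S \<subseteq> (\<Union>n. F n))"

definition baire_measurable :: "'a::topological_space set \<Rightarrow> bool" where
  "baire_measurable S \<longleftrightarrow> (\<exists>U. open U \<and> meager ((S - U) \<union> (U - S)))"

definition is_ideal :: "nat set set \<Rightarrow> bool" where
  "is_ideal \<I> \<longleftrightarrow> (\<forall>A\<in>\<I>. \<forall>B. B \<subseteq> A \<longrightarrow> B \<in> \<I>)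
                  \<and> (\<forall>A\<in>\<I>. \<forall>B\<in>\<I>. A \<union> B \<in> \<I>)
                  \<and> UNIV \<notin> \<I>"

definition contains_fin :: "nat set set \<Rightarrow> bool" where
  "contains_fin \<I> \<longleftrightarrow> (\<forall>A. finite A \<longrightarrow> A \<in> \<I>)"

definition ideal_in_cantor :: "nat set set \<Rightarrow> (nat \<Rightarrow> bool) set" where
  "ideal_in_cantor \<I> = (\<lambda>A n. n \<in> A) ` \<I>"

(* Colorings c : [omega]^2 -> 2, represented by c :: nat \<times> nat \<Rightarrow> bool where
   c {m,n} (m < n) is c (m,n); True = colour 1, False = colour 0.
   The values c (m,n) with m \<ge> n are irrelevant. *)
definition col :: "(nat \<times> nat \<Rightarrow> bool) \<Rightarrow> nat \<Rightarrow> nat \<Rightarrow> bool" where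
  "col c m n = c (min m n, max m n)"

definition subadditive :: "(nat \<times> nat \<Rightarrow> bool) \<Rightarrow> bool" where
  "subadditive c \<longleftrightarrow> (\<forall>m n k. m < n \<and> n < k \<longrightarrow>
      (of_bool (col c m n) :: nat) \<le> of_bool (col c m k) + of_bool (col c n k))"

definition zero_homogeneous :: "(nat \<times> nat \<Rightarrow> bool) \<Rightarrow> nat set \<Rightarrow> bool" where
  "zero_homogeneous c H \<longleftrightarrow> (\<forall>m\<in>H. \<forall>n\<in>H. m \<noteq> n \<longrightarrow> \<not> col c m n)"

definition nowhere_zero_homogeneous :: "nat set set \<Rightarrow> (nat \<times> nat \<Rightarrow> bool) \<Rightarrow> nat set \<Rightarrow> bool" where
  "nowhere_zero_homogeneous \<I> c H \<longleftrightarrow>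
     (\<forall>B. B \<subseteq> H \<and> B \<notin> \<I> \<longrightarrow> (\<exists>m\<in>B. \<exists>n\<in>B. m \<noteq> n \<and> col c m n))"

(* Uniformly weakly Ramsey: there is a Borel map Phi : [omega]^omega \<times> 2^([omega]^2) \<rightarrow> [omega]^omega
   (sets represented by characteristic functions, colorings as above) *)
definition uniformly_weakly_Ramsey :: "nat set set \<Rightarrow> bool" where
  "uniformly_weakly_Ramsey \<I> \<longleftrightarrow>
    (\<exists>\<Phi> :: (nat \<Rightarrow> bool) \<times> (nat \<times> nat \<Rightarrow> bool) \<Rightarrow> (nat \<Rightarrow> bool).
       \<Phi> \<in> borel_measurable borel \<and>
       (\<forall>A c. infinite {n. A n} \<longrightarrow> infinite {n. \<Phi> (A, c) n}) \<and>
       (\<forall>A c. A \<notin> \<I> \<and> subadditive c \<longrightarrow>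
          (let P = {n. \<Phi> ((\<lambda>n. n \<in> A), c) n} in
             P \<subseteq> A \<and> P \<notin> \<I> \<and>
             (zero_homogeneous c P \<or> nowhere_zero_homogeneous \<I> c P))))"

definition I_ED :: "nat set set \<Rightarrow> (nat \<Rightarrow> nat) \<Rightarrow> (nat \<Rightarrow> nat) \<Rightarrow> bool" where
  "I_ED \<I> f g \<longleftrightarrow> {n. f n = g n} \<in> \<I>"

definition I_MED :: "nat set set \<Rightarrow> (nat \<Rightarrow> nat) set \<Rightarrow> bool" where
  "I_MED \<I> E \<longleftrightarrow> (\<forall>f\<in>E. \<forall>g\<in>E. f \<noteq> g \<longrightarrow> I_ED \<I> f g)
                  \<and> (\<forall>h. \<exists>f\<in>E. \<not> I_ED \<I> f h)"

end

(* Functions are compared with the branch functions n |-> code of (g 0, ..., g (n-1)), which are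
   pairwise eventually different. Colour {m,n} with 0 if h(m) and h(n) lie on a common branch; this
   is subadditive. A 0-homogeneous positive set puts h on a single branch there, whereas on a
   nowhere 0-homogeneous set h is I-ED from every branch. Baire measurability gives (Talagrand) an
   interval partition all of whose infinite unions are positive, hence almost disjoint positive sets
   A_g. The family consists of the branches of all g, where the branch of g is overwritten by g
   itself on the set Phi(A_g, colouring of g) unless that set is 0-homogeneous: every h is then met
   either by its own patch or by a branch, and the patches are almost disjoint, so they do not
   interfere. *)
theory Submission
  imports Defs "HOL-Library.Nat_Bijection"
begin

section \<open>Meager sets in the Cantor space\<close>

lemma cylinder_open: "open {x :: nat \<Rightarrow> bool. \<forall>i<N. x i = s i}"
proof -
  have "open (Pi\<^sub>E UNIV (\<lambda>i. if i < N then {s i} else UNIV))"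
    by (rule open_PiE) (auto simp: open_discrete intro: finite_subset[of _ "{..<N}"])
  moreover have "Pi\<^sub>E UNIV (\<lambda>i. if i < N then {s i} else UNIV) = {x. \<forall>i<N. x i = s i}"
    by (auto simp: PiE_iff split: if_splits)
  ultimately show ?thesis by simp
qed

lemma open_contains_cylinder:
  fixes U :: "(nat \<Rightarrow> bool) set"
  assumes "open U" "x \<in> U"
  obtains N where "\<And>y. (\<And>i. i < N \<Longrightarrow> y i = x i) \<Longrightarrow> y \<in> U"
proof -
  have "openin (product_topology (\<lambda>i::nat. euclidean :: bool topology) UNIV) U"
    using \<open>open U\<close> by (simp add: open_fun_def)
  then obtain V where V: "finite {i \<in> UNIV. V i \<noteq> topspace (euclidean :: bool topology)}"
      "x \<in> Pi\<^sub>E UNIV V" "Pi\<^sub>E UNIV V \<subseteq> U"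
    using \<open>x \<in> U\<close> unfolding openin_product_topology_alt by meson
  then obtain N where N: "{i. V i \<noteq> UNIV} \<subseteq> {..<N}"
    using V(1) finite_nat_bounded[of "{i. V i \<noteq> UNIV}"] by auto
  show thesis
  proof (rule that)
    fix y assume y: "\<And>i. i < N \<Longrightarrow> y i = x i"
    have "y i \<in> V i" for i
      using V(2) N y[of i] by (cases "i < N") (auto simp: PiE_iff)
    then show "y \<in> U" using V(3) by (auto simp: PiE_iff)
  qed
qed

text \<open>A cylinder is a nonempty open set, so it has a point \<open>z\<close> outside the
  closure of \<open>C\<close>, and some cylinder around \<open>z\<close> misses that closure as
  well.\<close>

lemma nowhere_dense_avoid_cylinder:
  fixes C :: "(nat \<Rightarrow> bool) set"
  assumes "nowhere_dense C"
  obtains M z where "N \<le> M" "\<forall>i<N. z i = s i" "\<forall>x. (\<forall>i<M. x i = z i) \<longrightarrow> x \<notin> C"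
proof -
  let ?W = "{x. \<forall>i<N. x i = s i}"
  have "\<not> ?W \<subseteq> closure C"
    using assms interior_maximal[OF _ cylinder_open[of N s], of "closure C"]
    unfolding nowhere_dense_def by blast
  then obtain z where z: "\<And>i. i < N \<Longrightarrow> z i = s i" "z \<in> - closure C" by blast
  have "open (- closure C)" by auto
  then obtain M where M: "\<And>y. (\<And>i. i < M \<Longrightarrow> y i = z i) \<Longrightarrow> y \<in> - closure C"
    using open_contains_cylinder z(2) by metis
  show thesis
  proof (rule that[of "max M N" z])
    show "\<forall>x. (\<forall>i<max M N. x i = z i) \<longrightarrow> x \<notin> C"
    proof (intro allI impI)
      fix x assume "\<forall>i<max M N. x i = z i"
      then have "x \<in> - closure C" using M by simp
      then show "x \<notin> C" using closure_subset by blast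
    qed
  qed (use z in auto)
qed

text \<open>One block pattern serves finitely many pairs of a stem and a nowhere dense set: the
  pairs are treated in turn, each lengthening the block. Requirements met earlier persist, since the
  pattern already fixed is only extended.\<close>

lemma nowhere_dense_avoid_block:
  fixes C :: "'b \<Rightarrow> (nat \<Rightarrow> bool) set"
  assumes "finite P" "\<And>n. nowhere_dense (C n)"
  shows "\<exists>M t. N < M \<and>
    (\<forall>(s, n)\<in>P. \<forall>x. (\<forall>i<N. x i = s i) \<longrightarrow> (\<forall>i\<in>{N..<M}. x i = t i) \<longrightarrow> x \<notin> C n)"
  using assms(1)
proof (induction P)
  case empty
  then show ?case by auto
next
  case (insert p P)
  obtain s n where p: "p = (s, n)" by force
  from insert.IH obtain M t where M: "N < M" and
    IH: "\<forall>(s, n)\<in>P. \<forall>x. (\<forall>i<N. x i = s i) \<longrightarrow> (\<forall>i\<in>{N..<M}. x i = t i) \<longrightarrow> x \<notin> C n"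
    by (elim exE conjE)
  obtain M' z where z: "M \<le> M'" "\<forall>i<M. z i = (if i < N then s i else t i)"
    "\<forall>x. (\<forall>i<M'. x i = z i) \<longrightarrow> x \<notin> C n"
    by (rule nowhere_dense_avoid_cylinder[OF assms(2)[of n],
          where N = M and s = "\<lambda>i. if i < N then s i else t i"])
  have "x \<notin> C n'" if "(s', n') \<in> insert p P" "\<forall>i<N. x i = s' i" "\<forall>i\<in>{N..<M'}. x i = z i"
    for s' n' x
  proof (cases "(s', n') \<in> P")
    case True
    have "\<forall>i\<in>{N..<M}. x i = t i" using that(3) z(1,2) by auto
    then show ?thesis using bspec[OF IH True] that(2) by simp
  next
    case False
    then have eq: "s' = s" "n' = n" using that(1) p by auto
    have "x i = z i" if "i < M'" for i
      using that \<open>\<forall>i<N. x i = s' i\<close> \<open>\<forall>i\<in>{N..<M'}. x i = z i\<close> z(2) M eq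
      by (cases "i < N") auto
    then show ?thesis using z(3) eq by blast
  qed
  then show ?case using M z(1) by (intro exI[of _ M'] exI[of _ z]) auto
qed

definition block :: "(nat \<Rightarrow> nat) \<Rightarrow> nat \<Rightarrow> nat set" where
  "block k j = {k j..<k (Suc j)}"

lemma block_unique:
  assumes "strict_mono k" "n \<in> block k i" "n \<in> block k j"
  shows "i = j"
proof -
  have "k (Suc a) \<le> k b" if "a < b" for a b
    using that assms(1) by (simp add: strict_mono_less_eq)
  then show ?thesis
    using assms(2,3) unfolding block_def by (meson atLeastLessThan_iff leD le_less_trans linorder_neqE_nat)
qed

text \<open>The usual combinatorial description of meager sets. The block starting at
  \<open>N\<close> is chosen against all stems of length \<open>N\<close> and against
  \<open>C 0\<close>, ..., \<open>C (N - 1)\<close> at once, so a single match there already keeps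
  \<open>x\<close> out of these sets; infinitely many matches keep it out of all of them.\<close>

lemma meager_avoid_blocks:
  fixes S :: "(nat \<Rightarrow> bool) set"
  assumes "meager S"
  obtains k t where "strict_mono k"
    "\<And>x. infinite {j. \<forall>i\<in>block k j. x i = t i} \<Longrightarrow> x \<notin> S"
proof -
  from assms obtain C :: "nat \<Rightarrow> (nat \<Rightarrow> bool) set"
    where C: "\<And>n. nowhere_dense (C n)" "S \<subseteq> (\<Union>n. C n)"
    unfolding meager_def by blast
  \<comment> \<open>The finitely many stems of length \<open>N\<close>, each continued by
    \<open>False\<close> so that it is a point of the space.\<close>
  define pats where "pats N = (\<lambda>X i. i \<in> X) ` Pow {..<N}" for N :: nat
  have restrict: "(\<lambda>i. i < N \<and> x i) \<in> pats N" for N x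
    unfolding pats_def by (rule image_eqI[of _ _ "{i. i < N \<and> x i}"]) auto
  have "\<exists>M t. N < M \<and>
      (\<forall>x. (\<forall>i\<in>{N..<M}. x i = t i) \<longrightarrow> (\<forall>n<N. x \<notin> C n))" for N
  proof -
    have "finite (pats N \<times> {..<N})" by (simp add: pats_def)
    from nowhere_dense_avoid_block[of _ C N, OF this C(1)]
    obtain M t where Mt: "N < M" "\<forall>(s, n)\<in>pats N \<times> {..<N}. \<forall>x.
        (\<forall>i<N. x i = s i) \<longrightarrow> (\<forall>i\<in>{N..<M}. x i = t i) \<longrightarrow> x \<notin> C n"
      by (elim exE conjE)
    have "x \<notin> C n" if "\<forall>i\<in>{N..<M}. x i = t i" "n < N" for x n
      using bspec[OF Mt(2), of "(\<lambda>i. i < N \<and> x i, n)"] restrict[of N x] that by simp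
    then show ?thesis using Mt(1) by blast
  qed
  then obtain next_end pat where step: "\<And>N. N < next_end N"
    "\<And>N x n. \<forall>i\<in>{N..<next_end N}. x i = pat N i \<Longrightarrow> n < N \<Longrightarrow> x \<notin> C n"
    by metis
  define k where "k j = (next_end ^^ j) 0" for j
  have k_Suc: "k (Suc j) = next_end (k j)" for j by (simp add: k_def)
  have mono: "strict_mono k" by (rule strict_monoI_Suc) (simp add: k_Suc step(1))
  define t where "t i = pat (k (THE j. i \<in> block k j)) i" for i
  have t: "t i = pat (k j) i" if "i \<in> block k j" for i j
  proof -
    have "(THE j. i \<in> block k j) = j"
      using that block_unique[OF mono] by (intro the_equality)
    then show ?thesis by (simp add: t_def)
  qed
  show thesis
  proof (rule that[OF mono])
    fix x assume inf: "infinite {j. \<forall>i\<in>block k j. x i = t i}"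
    have "x \<notin> C n" for n
    proof -
      obtain j where j: "n < j" "\<forall>i\<in>block k j. x i = t i"
        using inf unfolding infinite_nat_iff_unbounded by blast
      have "n < k j" using j(1) strict_mono_imp_increasing[OF mono, of j] by simp
      moreover have "\<forall>i\<in>{k j..<next_end (k j)}. x i = pat (k j) i"
        using j(2) t by (simp add: block_def k_Suc)
      ultimately show ?thesis using step(2) by blast
    qed
    then show "x \<notin> S" using C(2) by blast
  qed
qed

section \<open>Baire measurable ideals: meagerness and Talagrand's interval partition\<close>

lemma in_ideal_in_cantor: "x \<in> ideal_in_cantor \<I> \<longleftrightarrow> {n. x n} \<in> \<I>"
proof
  assume "x \<in> ideal_in_cantor \<I>"
  then show "{n. x n} \<in> \<I>" unfolding ideal_in_cantor_def by auto
next
  assume "{n. x n} \<in> \<I>"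
  then show "x \<in> ideal_in_cantor \<I>" unfolding ideal_in_cantor_def
    by (intro image_eqI[of _ _ "{n. x n}"]) auto
qed

text \<open>The category zero-one law. If the ideal were comeager in a cylinder, then a point \<open>x\<close> of the
  cylinder that copies the avoiding pattern on even blocks and its negation on odd blocks would
  lie in the ideal together with its reflection, and these two cover a cofinite set.\<close>

lemma baire_ideal_meager:
  assumes ideal: "is_ideal \<I>" and fin: "contains_fin \<I>"
    and baire: "baire_measurable (ideal_in_cantor \<I>)"
  shows "meager (ideal_in_cantor \<I>)"
proof -
  from baire obtain U where U: "open U"
    "meager ((ideal_in_cantor \<I> - U) \<union> (U - ideal_in_cantor \<I>))" (is "meager ?D")
    unfolding baire_measurable_def by blast
  have "U = {}"
  proof (rule ccontr)
    assume "U \<noteq> {}"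
    then obtain s where s: "s \<in> U" by blast
    obtain N where N: "\<And>y. (\<And>i. i < N \<Longrightarrow> y i = s i) \<Longrightarrow> y \<in> U"
      using open_contains_cylinder[OF U(1) s] by blast
    obtain k t where mono: "strict_mono k" and
      kt: "\<And>x. infinite {j. \<forall>i\<in>block k j. x i = t i} \<Longrightarrow> x \<notin> ?D"
      using meager_avoid_blocks[OF U(2)] by blast
    have k_ge: "j \<le> k j" for j by (rule strict_mono_imp_increasing[OF mono])
    define even_part where "even_part = (\<Union>j. block k (2 * j))"
    have even: "i \<in> even_part" if "i \<in> block k (2 * j)" for i j
      using that by (auto simp: even_part_def)
    have odd: "i \<notin> even_part" if "i \<in> block k (2 * j + 1)" for i j
    proof
      assume "i \<in> even_part"
      then obtain m where "i \<in> block k (2 * m)" by (auto simp: even_part_def)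
      then have "2 * j + 1 = 2 * m" using that block_unique[OF mono] by blast
      then show False by presburger
    qed
    define x where "x i = (if i < N then s i else t i = (i \<in> even_part))" for i
    define y where "y i = (if i < N then s i else \<not> x i)" for i
    \<comment> \<open>Blocks of index at least \<open>N\<close> lie beyond the stem, so prescribing
      the first \<open>N\<close> values does not disturb the pattern there.\<close>
    have N_le: "N \<le> i" if "i \<in> block k j" "N \<le> j" for i j
      using that k_ge[of j] by (simp add: block_def)
    have inf: "infinite {j. \<exists>m\<ge>N. j = 2 * m + c}" for c
      unfolding infinite_nat_iff_unbounded
    proof
      fix n
      show "\<exists>j>n. j \<in> {j. \<exists>m\<ge>N. j = 2 * m + c}"
        by (intro exI[of _ "2 * (N + n + 1) + c"]) (auto intro!: exI[of _ "N + n + 1"])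
    qed
    have "{j. \<exists>m\<ge>N. j = 2 * m + 0} \<subseteq> {j. \<forall>i\<in>block k j. x i = t i}"
      by (auto simp: x_def even dest: N_le)
    then have "x \<notin> ?D" using kt inf infinite_super by blast
    moreover have "x \<in> U" by (rule N) (simp add: x_def)
    ultimately have x: "{n. x n} \<in> \<I>" by (simp add: in_ideal_in_cantor)
    have "{j. \<exists>m\<ge>N. j = 2 * m + 1} \<subseteq> {j. \<forall>i\<in>block k j. y i = t i}"
      using odd by (auto simp: x_def y_def dest: N_le)
    then have "y \<notin> ?D" using kt inf infinite_super by blast
    moreover have "y \<in> U" by (rule N) (simp add: y_def)
    ultimately have y: "{n. y n} \<in> \<I>" by (simp add: in_ideal_in_cantor)
    have "UNIV = {n. x n} \<union> {n. y n} \<union> {..<N}" by (auto simp: y_def)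
    also have "\<dots> \<in> \<I>"
      using x y ideal fin unfolding is_ideal_def contains_fin_def by blast
    finally show False using ideal by (simp add: is_ideal_def)
  qed
  then show ?thesis using U(2) by simp
qed

text \<open>The points of the chosen blocks at which \<open>t\<close> is true form a set that
  matches \<open>t\<close> on each of these blocks, hence lies outside the meager ideal. Downward
  closure passes this on to the whole union.\<close>

lemma baire_ideal_positive_blocks:
  assumes ideal: "is_ideal \<I>" and "contains_fin \<I>"
    and "baire_measurable (ideal_in_cantor \<I>)"
  obtains k where "strict_mono k" "\<And>X. infinite X \<Longrightarrow> (\<Union>j\<in>X. block k j) \<notin> \<I>"
proof -
  obtain k t where mono: "strict_mono k" and
    kt: "\<And>x. infinite {j. \<forall>i\<in>block k j. x i = t i} \<Longrightarrow> x \<notin> ideal_in_cantor \<I>"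
    using meager_avoid_blocks[OF baire_ideal_meager[OF assms]] by blast
  show thesis
  proof (rule that[OF mono])
    fix X :: "nat set" assume "infinite X"
    define x where "x i \<longleftrightarrow> t i \<and> i \<in> (\<Union>j\<in>X. block k j)" for i
    have "X \<subseteq> {j. \<forall>i\<in>block k j. x i = t i}" by (auto simp: x_def)
    then have "{i. x i} \<notin> \<I>"
      using kt[of x] \<open>infinite X\<close> infinite_super by (auto simp: in_ideal_in_cantor)
    moreover have "{i. x i} \<subseteq> (\<Union>j\<in>X. block k j)" by (auto simp: x_def)
    ultimately show "(\<Union>j\<in>X. block k j) \<notin> \<I>"
      using ideal unfolding is_ideal_def by blast
  qed
qed

section \<open>The branch coloring\<close>

definition branch :: "(nat \<Rightarrow> nat) \<Rightarrow> nat \<Rightarrow> nat" where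
  "branch g n = list_encode (map g [0..<n])"

lemma branch_eq_iff: "branch g m = branch h n \<longleftrightarrow> m = n \<and> (\<forall>i<n. g i = h i)"
proof -
  have "map g [0..<m] = map h [0..<n] \<Longrightarrow> m = n"
    by (metis diff_zero length_map length_upt)
  then show ?thesis by (auto simp: branch_def list_encode_eq)
qed

text \<open>Equal codes have equal length, and this length cannot exceed a place where
  \<open>g\<close> and \<open>h\<close> differ. The form with pairs yields both eventual difference
  of branches and almost disjointness of sets of codes.\<close>

lemma finite_branch_eq: "g \<noteq> h \<Longrightarrow> finite {(m, n). branch g m = branch h n}"
proof -
  assume "g \<noteq> h"
  then obtain i where "g i \<noteq> h i" by blast
  then have "{(m, n). branch g m = branch h n} \<subseteq> {..i} \<times> {..i}"
    by (auto simp: branch_eq_iff) (meson not_le)+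
  then show ?thesis by (rule finite_subset) simp
qed

text \<open>A value \<open>h m\<close> that does not code a sequence of length \<open>m\<close> lies
  on no branch, so every pair containing \<open>m\<close> then gets colour 1.\<close>

definition incoherent :: "(nat \<Rightarrow> nat) \<Rightarrow> nat \<times> nat \<Rightarrow> bool" where
  "incoherent h = (\<lambda>(m, n). \<nexists>g. h m = branch g m \<and> h n = branch g n)"

lemma col_incoherent: "col (incoherent h) m n \<longleftrightarrow> (\<nexists>g. h m = branch g m \<and> h n = branch g n)"
  by (auto simp: col_def incoherent_def min_def max_def)

text \<open>A tree argument: both branches pass through \<open>h k\<close>, so they agree below
  \<open>k\<close> and in particular at level \<open>n\<close>; one of them therefore carries
  \<open>h m\<close> and \<open>h n\<close>.\<close>

lemma subadditive_incoherent: "subadditive (incoherent h)"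
proof -
  have "\<not> col (incoherent h) m n"
    if "m < n" "n < k" "\<not> col (incoherent h) m k" "\<not> col (incoherent h) n k" for m n k
  proof -
    from that obtain g g' where "h m = branch g m" "h k = branch g k"
      "h n = branch g' n" "h k = branch g' k"
      unfolding col_incoherent by blast
    moreover from this have "branch g' n = branch g n"
      using \<open>n < k\<close> by (simp add: branch_eq_iff)
    ultimately show ?thesis unfolding col_incoherent by metis
  qed
  then show ?thesis unfolding subadditive_def by (auto simp: of_bool_def)
qed

text \<open>Serves to show that on a nowhere 0-homogeneous set the agreement of \<open>h\<close>
  with any branch belongs to the ideal.\<close>

lemma zero_homogeneous_branch:
  "zero_homogeneous (incoherent h) {n \<in> H. h n = branch g n}"
  unfolding zero_homogeneous_def col_incoherent by auto

text \<open>The entry \<open>g i\<close> is read off from the value of \<open>h\<close> at some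
  point of \<open>H\<close> beyond \<open>i\<close>; homogeneity makes all values of
  \<open>h\<close> on \<open>H\<close> agree about it.\<close>

lemma zero_homogeneous_imp_branch:
  assumes hom: "zero_homogeneous (incoherent h) H" and inf: "infinite H"
  obtains g where "\<And>n. n \<in> H \<Longrightarrow> h n = branch g n"
proof -
  have "\<exists>n. n \<in> H \<and> i < n" for i
    using inf unfolding infinite_nat_iff_unbounded by blast
  then obtain above where above: "\<And>i. above i \<in> H" "\<And>i. i < above i" by metis
  define g where "g i = list_decode (h (above i)) ! i" for i
  have "h n = branch g n" if "n \<in> H" for n
  proof -
    have "\<exists>f. h n = branch f n \<and> h m = branch f m" if "m \<in> H" "m \<noteq> n" for m
      using hom that \<open>n \<in> H\<close> unfolding zero_homogeneous_def col_incoherent by metis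
    moreover have "above n \<in> H" "above n \<noteq> n" using above[of n] by auto
    ultimately obtain f where f: "h n = branch f n" by blast
    have "f i = g i" if "i < n" for i
    proof -
      \<comment> \<open>Homogeneity speaks of distinct points only, so the case where the sampled
        point is \<open>n\<close> itself is separate.\<close>
      obtain f' where f': "h n = branch f' n" "h (above i) = branch f' (above i)"
      proof (cases "above i = n")
        case True
        then show ?thesis using f that by metis
      next
        case False
        then show ?thesis
          using that \<open>\<And>m. m \<in> H \<Longrightarrow> m \<noteq> n \<Longrightarrow> \<exists>f. h n = branch f n \<and> h m = branch f m\<close> above(1)
          by metis
      qed
      have "f i = f' i" using f f'(1) \<open>i < n\<close> by (simp add: branch_eq_iff)
      also have "f' i = g i" using f'(2) above(2) by (simp add: g_def branch_def)
      finally show ?thesis .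
    qed
    then show ?thesis using f by (simp add: branch_eq_iff)
  qed
  then show thesis by (rule that)
qed

section \<open>The maximal family\<close>

definition patched :: "((nat \<Rightarrow> nat) \<Rightarrow> nat set) \<Rightarrow> (nat \<Rightarrow> nat) \<Rightarrow> nat \<Rightarrow> nat" where
  "patched H g n =
    (if \<not> zero_homogeneous (incoherent g) (H g) \<and> n \<in> H g then g n else branch g n)"

text \<open>Agreement of two members splits into branch against branch (finite), patch against
  branch (in the ideal by nowhere 0-homogeneity) and patch against patch (inside a finite
  intersection).\<close>

lemma I_MED_range_patched:
  assumes ideal: "is_ideal \<I>" and fin: "contains_fin \<I>"
    and pos: "\<And>g. H g \<notin> \<I>"
    and hom: "\<And>g. zero_homogeneous (incoherent g) (H g) \<or>
      nowhere_zero_homogeneous \<I> (incoherent g) (H g)"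
    and ad: "\<And>g h. g \<noteq> h \<Longrightarrow> finite (H g \<inter> H h)"
  shows "I_MED \<I> (range (patched H))"
  unfolding I_MED_def
proof (intro conjI ballI impI allI)
  have sub: "B \<in> \<I>" if "A \<in> \<I>" "B \<subseteq> A" for A B
    using ideal that unfolding is_ideal_def by blast
  have un: "A \<union> B \<in> \<I>" if "A \<in> \<I>" "B \<in> \<I>" for A B
    using ideal that unfolding is_ideal_def by blast
  have finI: "A \<in> \<I>" if "finite A" for A
    using fin that unfolding contains_fin_def by blast
  \<comment> \<open>Where the patch of \<open>g\<close> meets the branch of \<open>h\<close>; empty
    if \<open>g\<close> receives no patch.\<close>
  define B where "B g h = {n. \<not> zero_homogeneous (incoherent g) (H g) \<and> n \<in> H g \<and> g n = branch h n}"
    for g h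
  have B: "B g h \<in> \<I>" for g h
  proof (cases "zero_homogeneous (incoherent g) (H g)")
    case True
    then show ?thesis using finI by (simp add: B_def)
  next
    case False
    then have "nowhere_zero_homogeneous \<I> (incoherent g) (H g)" using hom by blast
    moreover have "B g h = {n \<in> H g. g n = branch h n}" using False by (auto simp: B_def)
    ultimately show ?thesis
      using zero_homogeneous_branch[of g "H g" h]
      unfolding nowhere_zero_homogeneous_def zero_homogeneous_def by blast
  qed
  fix f f' assume "f \<in> range (patched H)" "f' \<in> range (patched H)" "f \<noteq> f'"
  then obtain g g' where g: "f = patched H g" "f' = patched H g'" "g \<noteq> g'" by blast
  have "finite {n. branch g n = branch g' n}"
    using finite_imageI[OF finite_branch_eq[OF g(3)], of fst]
    by (rule rev_finite_subset) force
  then have "{n. branch g n = branch g' n} \<union> (B g g' \<union> B g' g) \<union> (H g \<inter> H g') \<in> \<I>"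
    using B ad[OF g(3)] by (intro un B) (auto intro: finI)
  moreover have "{n. f n = f' n} \<subseteq>
      {n. branch g n = branch g' n} \<union> (B g g' \<union> B g' g) \<union> (H g \<inter> H g')"
    by (auto simp: g patched_def B_def split: if_splits)
  ultimately show "I_ED \<I> f f'" unfolding I_ED_def by (rule sub)
next
  have sub: "B \<in> \<I>" if "A \<in> \<I>" "B \<subseteq> A" for A B
    using ideal that unfolding is_ideal_def by blast
  fix h
  have "\<exists>g. \<not> I_ED \<I> (patched H g) h"
  proof (cases "zero_homogeneous (incoherent h) (H h)")
    case False
    then have "H h \<subseteq> {n. patched H h n = h n}" by (auto simp: patched_def)
    then show ?thesis using pos sub unfolding I_ED_def by blast
  next
    case True
    have "infinite (H h)" using pos fin unfolding contains_fin_def by blast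
    then obtain g where g: "\<And>n. n \<in> H h \<Longrightarrow> h n = branch g n"
      using zero_homogeneous_imp_branch[OF True] by blast
    \<comment> \<open>On \<open>H h\<close> the patch of \<open>g\<close> can hide
      \<open>branch g\<close> only inside \<open>H g\<close>. For \<open>g = h\<close> there is no
      patch, as \<open>H h\<close> is 0-homogeneous; otherwise the overlap is finite.\<close>
    define D where "D = (if g = h then {} else H g \<inter> H h)"
    have "H h \<subseteq> {n. patched H g n = h n} \<union> D"
      using g True by (auto simp: D_def patched_def)
    moreover have "D \<in> \<I>" using ad fin by (auto simp: D_def contains_fin_def)
    ultimately have "{n. patched H g n = h n} \<notin> \<I>"
      using pos[of h] ideal unfolding is_ideal_def by blast
    then show ?thesis unfolding I_ED_def by blast
  qed
  then show "\<exists>f\<in>range (patched H). \<not> I_ED \<I> f h" by blast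
qed

section \<open>Borel measurability\<close>

text \<open>Second countability lets Borel measurability of maps into spaces of sets and colorings
  be checked coordinatewise, and that of pairs componentwise.\<close>

instance bool :: second_countable_topology
proof
  have "open = generate_topology (UNIV :: bool set set)"
    by (auto simp: fun_eq_iff open_discrete intro: generate_topology.Basis)
  then show "\<exists>B :: bool set set. countable B \<and> open = generate_topology B" by blast
qed

lemma borel_measurable_eq_count_space:
  "borel_measurable M = (M \<rightarrow>\<^sub>M count_space (UNIV :: 'a :: {countable, t2_space} set))"
  by (rule measurable_cong_sets) (simp_all add: sets_borel_eq_count_space)

lemma measurable_borel_coordinate:
  fixes f :: "'a \<Rightarrow> 'b :: countable \<Rightarrow> 'c :: {countable, t2_space}"
  assumes "f \<in> borel_measurable M"
  shows "(\<lambda>x. f x i) \<in> M \<rightarrow>\<^sub>M count_space UNIV"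
  using measurable_product_then_coordinatewise[OF assms, of i]
  by (simp only: borel_measurable_eq_count_space)

text \<open>The range is the set of fixed points of \<open>F\<close> after \<open>D\<close>, and
  being fixed is a countable conjunction of coordinate conditions.\<close>

lemma borel_range_of_left_inverse:
  fixes F :: "'a :: topological_space \<Rightarrow> 'b :: countable \<Rightarrow> 'c :: {countable, t2_space}"
  assumes F: "F \<in> borel_measurable borel" and D: "D \<in> borel_measurable borel"
    and inv: "\<And>x. D (F x) = x"
  shows "range F \<in> sets borel"
proof -
  have [measurable]: "(\<lambda>y. F (D y) i) \<in> borel \<rightarrow>\<^sub>M count_space UNIV" for i
    by (intro measurable_borel_coordinate measurable_compose[OF D F])
  have [measurable]: "(\<lambda>y :: 'b \<Rightarrow> 'c. y i) \<in> borel \<rightarrow>\<^sub>M count_space UNIV" for i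
    by (rule measurable_borel_coordinate) simp
  have "Measurable.pred borel (\<lambda>y. \<forall>i. F (D y) i = y i)" by measurable
  moreover have "{y. \<forall>i. F (D y) i = y i} = range F"
    by (auto simp: inv simp flip: fun_eq_iff intro: range_eqI[OF sym])
  ultimately show ?thesis by (simp add: pred_def)
qed

lemma measurable_branch:
  assumes [measurable]: "\<And>i. (\<lambda>x. g x i) \<in> M \<rightarrow>\<^sub>M count_space UNIV"
  shows "(\<lambda>x. branch (g x) n) \<in> M \<rightarrow>\<^sub>M count_space UNIV"
proof -
  \<comment> \<open>Each fibre restricts only finitely many coordinates of
    \<open>g x\<close>.\<close>
  have eq: "branch (g x) n = a \<longleftrightarrow> length (list_decode a) = n \<and> (\<forall>i<n. g x i = list_decode a ! i)"
    for x a
  proof -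
    have "branch (g x) n = a \<longleftrightarrow> map (g x) [0..<n] = list_decode a"
      unfolding branch_def by (metis list_decode_inverse list_encode_inverse)
    then show ?thesis by (auto simp: list_eq_iff_nth_eq)
  qed
  have "Measurable.pred M (\<lambda>x. branch (g x) n = a)" for a
    unfolding eq by measurable
  then have "(\<lambda>x. branch (g x) n) -` {a} \<inter> space M \<in> sets M" for a
    by (simp add: pred_def vimage_def Int_def conj_commute)
  then show ?thesis by (simp add: measurable_count_space_eq2_countable)
qed

lemma measurable_incoherent: "incoherent \<in> borel_measurable borel"
proof (rule measurable_coordinatewise_then_product)
  fix p :: "nat \<times> nat"
  obtain m n where p: "p = (m, n)" by force
  have [measurable]: "(\<lambda>h :: nat \<Rightarrow> nat. h i) \<in> borel \<rightarrow>\<^sub>M count_space UNIV" for i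
    by (rule measurable_borel_coordinate) simp
  \<comment> \<open>Naming the two values by \<open>a\<close> and \<open>b\<close> turns the
    quantifier over functions into a constant condition on a pair of numbers; only countable
    quantifiers then involve \<open>h\<close>, and no projection occurs.\<close>
  have "Measurable.pred borel (\<lambda>h :: nat \<Rightarrow> nat. \<not> (\<exists>a b. h m = a \<and> h n = b \<and>
      (\<exists>g. a = branch g m \<and> b = branch g n)))"
    by measurable
  then show "(\<lambda>h. incoherent h p) \<in> borel_measurable borel"
    by (simp add: borel_measurable_eq_count_space incoherent_def p)
qed

lemma measurable_patched:
  assumes H: "\<And>n. Measurable.pred borel (\<lambda>g. n \<in> H g)"
  shows "patched H \<in> borel_measurable borel"
proof (rule measurable_coordinatewise_then_product)
  fix n
  note H [measurable]
  have [measurable]: "(\<lambda>h :: nat \<Rightarrow> nat. h i) \<in> borel \<rightarrow>\<^sub>M count_space UNIV" for i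
    by (rule measurable_borel_coordinate) simp
  have [measurable]: "Measurable.pred borel (\<lambda>g. incoherent g p)" for p
    by (rule measurable_borel_coordinate[OF measurable_incoherent])
  have [measurable]: "Measurable.pred borel (\<lambda>g. zero_homogeneous (incoherent g) (H g))"
    unfolding zero_homogeneous_def col_def Ball_def by measurable
  have [measurable]: "(\<lambda>g. branch g n) \<in> borel \<rightarrow>\<^sub>M count_space UNIV"
    by (rule measurable_branch) measurable
  have "(\<lambda>g. patched H g n) \<in> borel \<rightarrow>\<^sub>M count_space UNIV"
    unfolding patched_def by measurable
  then show "(\<lambda>g. patched H g n) \<in> borel_measurable borel"
    by (simp only: borel_measurable_eq_count_space)
qed

section \<open>Almost disjoint positive sets and the Borel range\<close>

text \<open>The factor 2 uses even blocks only, so that every patch leaves the odd blocks untouched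
  and \<open>g\<close> can be decoded there.\<close>

definition branch_blocks :: "(nat \<Rightarrow> nat) \<Rightarrow> (nat \<Rightarrow> nat) \<Rightarrow> nat set" where
  "branch_blocks k g = (\<Union>m. block k (2 * branch g m))"

text \<open>Distinct blocks are disjoint, so a common point lies in a block whose index comes from a
  code shared by \<open>g\<close> and \<open>h\<close>; such codes are finitely many.\<close>

lemma branch_blocks_almost_disjoint:
  assumes mono: "strict_mono k" and "g \<noteq> h"
  shows "finite (branch_blocks k g \<inter> branch_blocks k h)"
proof -
  have "branch_blocks k g \<inter> branch_blocks k h \<subseteq>
      (\<Union>(m, n)\<in>{(m, n). branch g m = branch h n}. block k (2 * branch g m))"
    unfolding branch_blocks_def using block_unique[OF mono] by fastforce
  then show ?thesis
    by (rule finite_subset) (use finite_branch_eq[OF \<open>g \<noteq> h\<close>] in \<open>auto simp: block_def\<close>)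
qed

lemma branch_blocks_avoids_odd:
  assumes "strict_mono k"
  shows "k (2 * j + 1) \<notin> branch_blocks k g"
proof
  assume "k (2 * j + 1) \<in> branch_blocks k g"
  then obtain m where "k (2 * j + 1) \<in> block k (2 * branch g m)"
    by (auto simp: branch_blocks_def)
  moreover have "k (2 * j + 1) \<in> block k (2 * j + 1)"
    using assms by (simp add: block_def strict_mono_less)
  ultimately have "2 * branch g m = 2 * j + 1" by (rule block_unique[OF assms])
  then show False by presburger
qed

text \<open>A patched function still is \<open>branch g\<close> at the odd block ends, so it determines \<open>g\<close> there;
  this replaces an appeal to the Lusin--Souslin theorem.\<close>

lemma borel_range_patched:
  assumes mono: "strict_mono k" and H: "\<And>n. Measurable.pred borel (\<lambda>g. n \<in> H g)"
    and sub: "\<And>g. H g \<subseteq> branch_blocks k g"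
  shows "range (patched H) \<in> sets borel"
proof (rule borel_range_of_left_inverse[OF measurable_patched[OF H]])
  let ?D = "\<lambda>(f :: nat \<Rightarrow> nat) j. list_decode (f (k (2 * j + 1))) ! j"
  show "?D \<in> borel_measurable borel"
  proof (rule measurable_coordinatewise_then_product)
    fix j
    have "(\<lambda>f :: nat \<Rightarrow> nat. f (k (2 * j + 1))) \<in> borel \<rightarrow>\<^sub>M count_space UNIV"
      by (rule measurable_borel_coordinate) simp
    then show "(\<lambda>f. ?D f j) \<in> borel_measurable borel"
      by (rule measurable_compose) simp
  qed
  fix g
  show "?D (patched H g) = g"
  proof
    fix j
    have "k (2 * j + 1) \<notin> H g" using branch_blocks_avoids_odd[OF mono] sub by blast
    \<comment> \<open>The code read at this point lists the first \<open>k (2 * j + 1)\<close>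
      values of \<open>g\<close>, so it does have an entry at position \<open>j\<close>.\<close>
    moreover have "j < k (2 * j + 1)" using strict_mono_imp_increasing[OF mono, of "2 * j + 1"] by simp
    ultimately show "?D (patched H g) j = g j" by (simp add: patched_def branch_def)
  qed
qed

theorem theorem4p8:
  fixes \<I> :: "nat set set"
  assumes "is_ideal \<I>"
    and "contains_fin \<I>"
    and "baire_measurable (ideal_in_cantor \<I>)"
    and "uniformly_weakly_Ramsey \<I>"
  shows "\<exists>E :: (nat \<Rightarrow> nat) set. E \<in> sets borel \<and> I_MED \<I> E"
proof -
  obtain k where mono: "strict_mono k"
    and pos: "\<And>X. infinite X \<Longrightarrow> (\<Union>j\<in>X. block k j) \<notin> \<I>"
    using baire_ideal_positive_blocks[OF assms(1-3)] by blast
  from assms(4) obtain \<Phi> :: "(nat \<Rightarrow> bool) \<times> (nat \<times> nat \<Rightarrow> bool) \<Rightarrow> nat \<Rightarrow> bool"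
    where \<Phi>: "\<Phi> \<in> borel_measurable borel"
    and ramsey: "\<And>A c. A \<notin> \<I> \<Longrightarrow> subadditive c \<Longrightarrow>
      {n. \<Phi> (\<lambda>n. n \<in> A, c) n} \<subseteq> A \<and> {n. \<Phi> (\<lambda>n. n \<in> A, c) n} \<notin> \<I> \<and>
      (zero_homogeneous c {n. \<Phi> (\<lambda>n. n \<in> A, c) n} \<or>
       nowhere_zero_homogeneous \<I> c {n. \<Phi> (\<lambda>n. n \<in> A, c) n})"
    unfolding uniformly_weakly_Ramsey_def Let_def by blast
  define H where "H g = {n. \<Phi> (\<lambda>n. n \<in> branch_blocks k g, incoherent g) n}" for g
  have bb: "branch_blocks k g \<notin> \<I>" for g
  proof -
    \<comment> \<open>Codes of different lengths differ, so infinitely many blocks are used and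
      their union is positive.\<close>
    have "inj (\<lambda>m. 2 * branch g m)" by (auto simp: inj_on_def branch_eq_iff)
    then have "infinite (range (\<lambda>m. 2 * branch g m))" by (rule range_inj_infinite)
    from pos[OF this] show ?thesis by (simp add: branch_blocks_def)
  qed
  have H: "H g \<subseteq> branch_blocks k g" "H g \<notin> \<I>"
    "zero_homogeneous (incoherent g) (H g) \<or> nowhere_zero_homogeneous \<I> (incoherent g) (H g)" for g
    using ramsey[OF bb subadditive_incoherent, of g g] unfolding H_def by blast+
  have [measurable]: "Measurable.pred borel (\<lambda>g. n \<in> branch_blocks k g)" for n
  proof -
    have [measurable]: "(\<lambda>g. branch g m) \<in> borel \<rightarrow>\<^sub>M count_space UNIV" for m
      by (intro measurable_branch measurable_borel_coordinate) simp
    \<comment> \<open>Quantifying over the value \<open>a\<close> leaves a countable union of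
      conditions \<open>branch g m = a\<close>.\<close>
    have eq: "n \<in> branch_blocks k g \<longleftrightarrow> (\<exists>m a. branch g m = a \<and> n \<in> block k (2 * a))" for g
      by (auto simp: branch_blocks_def)
    show ?thesis unfolding eq by measurable
  qed
  have "(\<lambda>g n. n \<in> branch_blocks k g) \<in> borel_measurable borel"
    by (rule measurable_coordinatewise_then_product) (simp add: borel_measurable_eq_count_space)
  then have "(\<lambda>g. \<Phi> (\<lambda>n. n \<in> branch_blocks k g, incoherent g)) \<in> borel_measurable borel"
    by (intro measurable_compose[OF _ \<Phi>] borel_measurable_Pair measurable_incoherent)
  then have "Measurable.pred borel (\<lambda>g. n \<in> H g)" for n
    unfolding H_def mem_Collect_eq by (rule measurable_borel_coordinate)
  then have "range (patched H) \<in> sets borel"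
    using borel_range_patched[OF mono] H(1) by blast
  moreover have "I_MED \<I> (range (patched H))"
  proof (rule I_MED_range_patched[OF assms(1,2)])
    show "finite (H g \<inter> H h)" if "g \<noteq> h" for g h
      using branch_blocks_almost_disjoint[OF mono that] H(1) by (meson Int_mono finite_subset)
  qed (fact H)+
  ultimately show ?thesis by blast
qed

end
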